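(* Let $z_1,z_2,z_3,z_4$ be independent random points, each uniformly distributed on the unit circle $\mathbb{S}^1\subset\mathbb{C}$, and let $\lambda=[z_1,z_2,z_3,z_4]$ be their cross ratio (a real-valued random variable, defined almost surely). Then $\lambda$ has probability density function given by \[ \frac{1}{\pi^2}\left(\frac{\log(1-r)}{(r-1)r}+\frac{\log\left(1-\frac1r\right)}{1-r}\right)\quad\text{if } r<0, \] \[ \frac{1}{\pi^2}\left(\frac{\log\left(\frac{1}{1-r}\right)}{r}+\frac{\log\left(\frac1r\right)}{1-r}\right)\quad\text{if } 0<r<1, \] \[ \frac{1}{\pi^2}\left(\frac{\log r}{(r-1)r}+\frac{\log\left(\frac{r}{r-1}\right)}{r}\right)\quad\text{if } r>1 . \]
   Context: The cross ratio of four distinct points is $[z_1,z_2,z_3,z_4]=\dfrac{(z_1-z_3)(z_2-z_4)}{(z_1-z_2)(z_3-z_4)}$; it is real when the four points lie on a circle. *)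

theory Defs
  imports "HOL-Probability.Probability"
begin

definition cross_ratio :: "complex \<Rightarrow> complex \<Rightarrow> complex \<Rightarrow> complex \<Rightarrow> complex" where
  "cross_ratio z1 z2 z3 z4 = ((z1 - z3) * (z2 - z4)) / ((z1 - z2) * (z3 - z4))"

(* Normalized arc length on the unit circle, as a measure on the Borel sets of the plane. *)
definition uniform_circle :: "complex measure" where
  "uniform_circle = distr (uniform_measure lborel {0..<2 * pi}) borel cis"

(* The values at r = 0 and r = 1 are immaterial (a null set) and are set to 0. *)
definition cross_ratio_density :: "real \<Rightarrow> real" where
  "cross_ratio_density r =
     (if r < 0 then
        1 / pi\<^sup>2 * (ln (1 - r) / ((r - 1) * r) + ln (1 - 1 / r) / (1 - r))
      else if 0 < r \<and> r < 1 then
        1 / pi\<^sup>2 * (ln (1 / (1 - r)) / r + ln (1 / r) / (1 - r))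
      else if r > 1 then
        1 / pi\<^sup>2 * (ln r / ((r - 1) * r) + ln (r / (r - 1)) / r)
      else 0)"

end

theory Submission
  imports Defs "HOL-Real_Asymp.Real_Asymp"
begin

text \<open>
  Projecting the circle stereographically from the point \<open>z 1\<close> turns the uniform measure into the
  standard Cauchy distribution, with density \<open>c(x) = 1 / (\<pi> (1 + x\<^sup>2))\<close>, and does so for every position
  of \<open>z 1\<close> because the uniform measure is rotation invariant. Hence, given \<open>z 1\<close>, the other three
  points become independent Cauchy variables \<open>s\<close>, \<open>t\<close>, \<open>u\<close>. The cross ratio is invariant under
  Moebius maps and its first point has gone to infinity, so it equals \<open>(s - u) / (t - u)\<close>
  (\<open>cross_ratio_cayley\<close>). This is real, and its law does not depend on \<open>z 1\<close>.

  Changing variables from \<open>(s, t, u)\<close> to \<open>(r, y, u)\<close> with \<open>y = t - u\<close> and \<open>s = u + r y\<close>, whose Jacobian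
  is \<open>\<bar>y\<bar>\<close>, shows that the ratio has the density
  \<open>f(r) = \<integral> \<bar>y\<bar> (\<integral> c(u) c(u + y) c(u + r y) du) dy\<close>.
  Both integrals are elementary. The integrand of the inner one is rational in \<open>u\<close>, and partial
  fractions give (\<open>nn_integral_cauchy_triple\<close>)
  \<open>2 (12 + a\<^sup>2 - a b + b\<^sup>2) / (\<pi>\<^sup>2 (4 + a\<^sup>2) (4 + b\<^sup>2) (4 + (a - b)\<^sup>2))\<close> with \<open>a = y\<close> and \<open>b = r y\<close>.
  The outer integrand is then \<open>\<bar>y\<bar>\<close> times a rational function of \<open>y\<^sup>2\<close>, and partial fractions once more
  give (\<open>nn_integral_abs_cauchy_triple\<close>)
  \<open>f(r) = (1 / \<pi>\<^sup>2) (ln \<bar>r\<bar> / (r - 1) - ln \<bar>1 - r\<bar> / r)\<close>,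
  of which the three branches in the definition of the density are the restrictions to \<open>r < 0\<close>,
  \<open>0 < r < 1\<close> and \<open>r > 1\<close>.
\<close>

section \<open>Integrals over half-lines and the line\<close>

text \<open>
  The substitution \<open>x \<mapsto> - x\<close> reduces this to \<open>nn_integral_FTC_atLeast\<close>.
\<close>

lemma nn_integral_FTC_atMost:
  fixes f :: "real \<Rightarrow> real"
  assumes [measurable]: "f \<in> borel_measurable borel"
    and deriv: "\<And>x. x \<le> a \<Longrightarrow> DERIV F x :> f x"
    and nonneg: "\<And>x. x \<le> a \<Longrightarrow> 0 \<le> f x"
    and lim: "(F \<longlongrightarrow> T) at_bot"
  shows "(\<integral>\<^sup>+x. ennreal (f x) * indicator {..a} x \<partial>lborel) = ennreal (F a - T)"
proof -
  have "(\<integral>\<^sup>+x. ennreal (f x) * indicator {..a} x \<partial>lborel)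
      = (\<integral>\<^sup>+x. ennreal (f (- x)) * indicator {- a..} x \<partial>lborel)"
    by (subst nn_integral_real_affine[where c="-1" and t=0])
       (auto intro!: nn_integral_cong split: split_indicator)
  also have "\<dots> = ennreal (- T - (- F (- (- a))))"
  proof (rule nn_integral_FTC_atLeast)
    show "DERIV (\<lambda>x. - F (- x)) x :> f (- x)" if "- a \<le> x" for x
    proof -
      have "DERIV (\<lambda>x. F (- x)) x :> f (- x) * - 1"
        using deriv[of "- x"] that
        by (intro DERIV_chain2[where f=F and g=uminus]) (auto intro!: derivative_eq_intros)
      then show ?thesis by (auto intro!: derivative_eq_intros)
    qed
    show "0 \<le> f (- x)" if "- a \<le> x" for x using nonneg that by simp
    show "((\<lambda>x. - F (- x)) \<longlongrightarrow> - T) at_top"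
      by (intro tendsto_minus filterlim_compose[OF lim] filterlim_uminus_at_bot_at_top)
  qed measurable
  finally show ?thesis by simp
qed

lemma nn_integral_split_at:
  fixes f :: "real \<Rightarrow> ennreal"
  assumes [measurable]: "f \<in> borel_measurable borel"
  shows "(\<integral>\<^sup>+x. f x \<partial>lborel)
    = (\<integral>\<^sup>+x. f x * indicator {..a} x \<partial>lborel) + (\<integral>\<^sup>+x. f x * indicator {a..} x \<partial>lborel)"
proof -
  have "(\<integral>\<^sup>+x. f x \<partial>lborel) = (\<integral>\<^sup>+x. f x * indicator {..a} x + f x * indicator {a..} x \<partial>lborel)"
    by (intro nn_integral_cong_AE) (use AE_lborel_singleton[of a] in \<open>auto split: split_indicator\<close>)
  then show ?thesis by (simp add: nn_integral_add)
qed

lemma nn_integral_FTC_line: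
  fixes f :: "real \<Rightarrow> real"
  assumes [measurable]: "f \<in> borel_measurable borel"
    and deriv: "\<And>x. DERIV F x :> f x"
    and nonneg: "\<And>x. 0 \<le> f x"
    and bot: "(F \<longlongrightarrow> A) at_bot" and top: "(F \<longlongrightarrow> B) at_top"
  shows "(\<integral>\<^sup>+x. ennreal (f x) \<partial>lborel) = ennreal (B - A)"
proof -
  have mono: "F x \<le> F y" if "x \<le> y" for x y
    using DERIV_nonneg_imp_nondecreasing[OF that] deriv nonneg by blast
  have "A \<le> F 0"
    by (rule tendsto_upperbound[OF bot])
       (auto simp: eventually_at_bot_linorder intro!: exI[of _ 0] mono)
  moreover have "F 0 \<le> B"
    by (rule tendsto_lowerbound[OF top])
       (auto simp: eventually_at_top_linorder intro!: exI[of _ 0] mono)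
  moreover have "(\<integral>\<^sup>+x. ennreal (f x) * indicator {..0} x \<partial>lborel) = ennreal (F 0 - A)"
    by (rule nn_integral_FTC_atMost) (use assms in auto)
  moreover have "(\<integral>\<^sup>+x. ennreal (f x) * indicator {0..} x \<partial>lborel) = ennreal (B - F 0)"
    by (rule nn_integral_FTC_atLeast) (use assms in auto)
  ultimately show ?thesis
    by (subst nn_integral_split_at[of _ 0]) (simp_all flip: ennreal_plus)
qed

lemma nn_integral_lborel_shift:
  fixes a :: real
  assumes "f \<in> borel_measurable borel"
  shows "(\<integral>\<^sup>+x. f (x + a) \<partial>lborel) = (\<integral>\<^sup>+x. f x \<partial>lborel)"
  using nn_integral_real_affine[OF assms, of 1 a] by (simp add: add.commute)

section \<open>The standard Cauchy distribution\<close>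

definition cauchy_density :: "real \<Rightarrow> real" where
  "cauchy_density x = 1 / (pi * (1 + x\<^sup>2))"

definition cauchy :: "real measure" where
  "cauchy = density lborel (\<lambda>x. ennreal (cauchy_density x))"

lemma one_plus_square_pos [simp]: "1 + (x::real)\<^sup>2 > 0" "1 + (x::real)\<^sup>2 \<noteq> 0"
  by (auto simp: add_pos_nonneg) (metis add_pos_nonneg less_irrefl zero_le_power2 zero_less_one)

lemma cauchy_density_measurable [measurable]: "cauchy_density \<in> borel_measurable borel"
  unfolding cauchy_density_def by measurable

lemma cauchy_density_nonneg [simp]: "cauchy_density x \<ge> 0"
  by (simp add: cauchy_density_def)

lemma sets_cauchy [simp, measurable_cong]: "sets cauchy = sets borel"
  by (simp add: cauchy_def)

lemma space_cauchy [simp]: "space cauchy = UNIV"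
  by (simp add: cauchy_def)

lemma nn_integral_cauchy:
  assumes "f \<in> borel_measurable borel"
  shows "(\<integral>\<^sup>+x. f x \<partial>cauchy) = (\<integral>\<^sup>+x. ennreal (cauchy_density x) * f x \<partial>lborel)"
  using assms by (simp add: cauchy_def nn_integral_density)

lemma DERIV_arctan_cauchy_density:
  "DERIV (\<lambda>x. arctan x / pi) x :> cauchy_density x"
  unfolding cauchy_density_def
  by (auto intro!: derivative_eq_intros simp: inverse_eq_divide mult.commute)

lemma arctan_over_pi_at_bot: "((\<lambda>x. arctan x / pi) \<longlongrightarrow> - (1 / 2)) at_bot"
  using tendsto_divide[OF tendsto_arctan_at_bot tendsto_const, of pi] by simp

lemma arctan_over_pi_at_top: "((\<lambda>x. arctan x / pi) \<longlongrightarrow> 1 / 2) at_top"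
  using tendsto_divide[OF tendsto_arctan_at_top tendsto_const, of pi] by simp

lemma prob_space_cauchy: "prob_space cauchy"
proof
  have "(\<integral>\<^sup>+x. ennreal (cauchy_density x) \<partial>lborel) = ennreal (1 / 2 - - (1 / 2))"
    by (rule nn_integral_FTC_line[OF _ DERIV_arctan_cauchy_density])
       (simp_all add: arctan_over_pi_at_bot[simplified] arctan_over_pi_at_top[simplified])
  then show "emeasure cauchy (space cauchy) = 1"
    by (simp add: cauchy_def emeasure_density)
qed

lemma emeasure_cauchy_atMost: "emeasure cauchy {..t} = ennreal (arctan t / pi + 1 / 2)"
proof -
  have "emeasure cauchy {..t} = ennreal (arctan t / pi - - (1 / 2))"
    unfolding cauchy_def
    by (subst emeasure_density, simp, simp,
        rule nn_integral_FTC_atMost[OF _ DERIV_arctan_cauchy_density])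
       (simp_all add: arctan_over_pi_at_bot[simplified])
  then show ?thesis by simp
qed

section \<open>The uniform measure on the circle as a projected Cauchy distribution\<close>

text \<open>
  Up to a reflection, the inverse of stereographic projection from the point \<open>1\<close>, which corresponds
  to \<open>s = \<infinity>\<close>.
\<close>

definition cayley :: "real \<Rightarrow> complex" where
  "cayley s = (of_real s - \<i>) / (of_real s + \<i>)"

lemma of_real_plus_ii_nonzero [simp]: "complex_of_real s + \<i> \<noteq> 0"
  by (simp add: complex_eq_iff)

lemma cayley_measurable [measurable]: "cayley \<in> borel_measurable borel"
  unfolding cayley_def by measurable

lemma inj_cayley: "inj cayley"
proof (rule injI)
  fix s t assume "cayley s = cayley t"
  then have "(of_real s - \<i>) * (of_real t + \<i>) = (of_real t - \<i>) * (of_real s + \<i>)"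
    by (simp add: cayley_def frac_eq_eq)
  then show "s = t" by (simp add: complex_eq_iff)
qed

text \<open>
  With \<open>a = \<theta>/2 - \<pi>/2\<close> one has \<open>tan a \<plusminus> \<i> = \<plusminus> \<i> exp (\<mp> \<i> a) / cos a\<close>, so the Cayley
  quotient is \<open>- exp (2 \<i> a) = exp (\<i> \<theta>)\<close>.
\<close>

lemma cis_eq_cayley:
  assumes "0 < \<theta>" "\<theta> < 2 * pi"
  shows "cis \<theta> = cayley (tan (\<theta> / 2 - pi / 2))"
proof -
  define a where "a = \<theta> / 2 - pi / 2"
  have a: "- pi / 2 < a" "a < pi / 2" using assms by (auto simp: a_def)
  have c: "cos a \<noteq> 0" using cos_gt_zero_pi[of a] a by auto
  have "cis \<theta> = - (cis a)\<^sup>2"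
  proof -
    have "\<theta> = 2 * a + pi" by (simp add: a_def)
    then have "cis \<theta> = cis a * cis a * cis pi" by (simp only: cis_mult mult_2)
    then show ?thesis by (simp add: power2_eq_square)
  qed
  also have "\<dots> = cayley (tan a)"
  proof -
    have "complex_of_real (tan a) + \<i> = \<i> * cnj (cis a) / cos a"
      "complex_of_real (tan a) - \<i> = - \<i> * cis a / cos a"
      using c by (simp_all add: complex_eq_iff tan_def Re_divide_of_real Im_divide_of_real)
    then have "cayley (tan a) = (- \<i> * cis a) / (\<i> * cnj (cis a))"
      using c by (simp add: cayley_def)
    also have "\<dots> = - (cis a / cis (- a))" by (simp add: cis_cnj)
    also have "\<dots> = - (cis a)\<^sup>2" by (simp add: cis_divide power2_eq_square cis_mult)
    finally show ?thesis ..
  qed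
  finally show ?thesis by (simp add: a_def)
qed

lemma cis_measurable [measurable]: "cis \<in> borel_measurable borel"
  by (intro borel_measurable_continuous_onI continuous_intros)

lemma sets_uniform_circle [simp, measurable_cong]: "sets uniform_circle = sets borel"
  by (simp add: uniform_circle_def)

lemma space_uniform_circle [simp]: "space uniform_circle = UNIV"
  by (simp add: uniform_circle_def)

lemma nn_integral_uniform_circle:
  assumes [measurable]: "f \<in> borel_measurable borel"
  shows "(\<integral>\<^sup>+w. f w \<partial>uniform_circle)
    = (\<integral>\<^sup>+\<theta>. f (cis \<theta>) * indicator {0..<2 * pi} \<theta> \<partial>lborel) / ennreal (2 * pi)"
  unfolding uniform_circle_def
  by (simp add: nn_integral_distr nn_integral_uniform_measure)

lemma nn_integral_rotate_uniform_circle: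
  assumes f [measurable]: "f \<in> borel_measurable borel" and "norm c = 1"
  shows "(\<integral>\<^sup>+w. f (c * w) \<partial>uniform_circle) = (\<integral>\<^sup>+w. f w \<partial>uniform_circle)"
proof -
  define a where "a = Arg2pi c"
  have a: "0 \<le> a" "a < 2 * pi" "c = cis a"
    using Arg2pi[of c] \<open>norm c = 1\<close> by (simp_all add: a_def cis_conv_exp is_Arg_def)
  have cis_a: "c * cis \<theta> = cis (\<theta> + a)" for \<theta>
    by (simp add: a cis_mult add.commute)
  have cis_2pi: "cis (\<theta> + 2 * pi) = cis \<theta>" for \<theta>
    by (simp flip: cis_mult)
  define g where "g A \<theta> = f (cis \<theta>) * indicator A \<theta>" for A \<theta>
  have [measurable]: "g A \<in> borel_measurable borel" if "A \<in> sets borel" for A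
    using that unfolding g_def by measurable
  \<comment> \<open>The rotated interval sticks out of the period \<open>[0, 2\<pi>)\<close> by \<open>[2\<pi>, 2\<pi> + a)\<close>;
    a shift by one period moves that piece back to \<open>[0, a)\<close>.\<close>
  have "(\<integral>\<^sup>+\<theta>. f (c * cis \<theta>) * indicator {0..<2 * pi} \<theta> \<partial>lborel)
      = (\<integral>\<^sup>+\<theta>. g {a..<2 * pi + a} (\<theta> + a) \<partial>lborel)"
    unfolding cis_a g_def by (intro nn_integral_cong) (simp split: split_indicator)
  also have "\<dots> = (\<integral>\<^sup>+\<theta>. g {a..<2 * pi + a} \<theta> \<partial>lborel)"
    by (rule nn_integral_lborel_shift) simp
  also have "\<dots> = (\<integral>\<^sup>+\<theta>. g {a..<2 * pi} \<theta> + g {2 * pi..<2 * pi + a} \<theta> \<partial>lborel)"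
    using a unfolding g_def by (intro nn_integral_cong) (auto split: split_indicator)
  also have "\<dots> = (\<integral>\<^sup>+\<theta>. g {a..<2 * pi} \<theta> \<partial>lborel)
      + (\<integral>\<^sup>+\<theta>. g {2 * pi..<2 * pi + a} \<theta> \<partial>lborel)"
    by (simp add: nn_integral_add)
  also have "(\<integral>\<^sup>+\<theta>. g {2 * pi..<2 * pi + a} \<theta> \<partial>lborel)
      = (\<integral>\<^sup>+\<theta>. g {2 * pi..<2 * pi + a} (\<theta> + 2 * pi) \<partial>lborel)"
    by (rule nn_integral_lborel_shift[symmetric]) simp
  also have "\<dots> = (\<integral>\<^sup>+\<theta>. g {0..<a} \<theta> \<partial>lborel)"
    unfolding g_def cis_2pi by (intro nn_integral_cong) (auto split: split_indicator)
  also have "(\<integral>\<^sup>+\<theta>. g {a..<2 * pi} \<theta> \<partial>lborel) + \<dots>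
      = (\<integral>\<^sup>+\<theta>. g {a..<2 * pi} \<theta> + g {0..<a} \<theta> \<partial>lborel)"
    by (simp add: nn_integral_add)
  also have "\<dots> = (\<integral>\<^sup>+\<theta>. f (cis \<theta>) * indicator {0..<2 * pi} \<theta> \<partial>lborel)"
    using a unfolding g_def by (intro nn_integral_cong) (auto split: split_indicator)
  finally show ?thesis by (simp add: nn_integral_uniform_circle)
qed

text \<open>
  Comparing distribution functions: \<open>tan (\<theta>/2 - \<pi>/2) \<le> t\<close> means \<open>\<theta> \<le> 2 arctan t + \<pi>\<close>, which has
  probability \<open>arctan t / \<pi> + 1/2\<close>.
\<close>

lemma cauchy_eq_distr_tan:
  "cauchy = distr (uniform_measure lborel {0..<2 * pi}) borel (\<lambda>\<theta>. tan (\<theta> / 2 - pi / 2))"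
    (is "_ = distr ?U _ ?T")
proof (rule cdf_unique)
  interpret U: prob_space ?U by (rule prob_space_uniform_measure) auto
  have T [measurable]: "?T \<in> borel_measurable borel"
    unfolding tan_def by measurable
  have TU: "?T \<in> measurable ?U borel" by simp
  interpret D: prob_space "distr ?U borel ?T" by (rule U.prob_space_distr[OF TU])
  interpret C: prob_space cauchy by (rule prob_space_cauchy)
  show "real_distribution cauchy" by standard simp
  show "real_distribution (distr ?U borel ?T)" by standard simp
  show "cdf cauchy = cdf (distr ?U borel ?T)"
  proof
    fix t
    have at: "- (pi / 2) < arctan t" "arctan t < pi / 2"
      using arctan_lbound[of t] arctan_ubound[of t] by auto
    have "emeasure (distr ?U borel ?T) {..t} = emeasure ?U (?T -` {..t})"
      by (subst emeasure_distr) auto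
    also have "\<dots> = emeasure lborel ({0..<2 * pi} \<inter> ?T -` {..t}) / ennreal (2 * pi)"
      by (subst emeasure_uniform_measure) (auto intro: measurable_sets_borel[OF T])
    also have "emeasure lborel ({0..<2 * pi} \<inter> ?T -` {..t})
        = emeasure lborel {0..2 * arctan t + pi}"
    proof (rule emeasure_eq_AE)
      have "?T \<theta> \<le> t \<longleftrightarrow> \<theta> \<le> 2 * arctan t + pi" if "0 < \<theta>" "\<theta> < 2 * pi" for \<theta>
      proof -
        have "arctan (?T \<theta>) = \<theta> / 2 - pi / 2"
          by (rule arctan_tan) (use that in auto)
        then show ?thesis using arctan_le_iff[of "?T \<theta>" t] by (auto simp: field_simps)
      qed
      then show "AE \<theta> in lborel. \<theta> \<in> {0..<2 * pi} \<inter> ?T -` {..t} \<longleftrightarrow> \<theta> \<in> {0..2 * arctan t + pi}"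
        using AE_lborel_singleton[of 0] at by (auto simp: less_le elim!: eventually_mono)
    qed auto
    also have "\<dots> / ennreal (2 * pi) = ennreal (arctan t / pi + 1 / 2)"
      using at by (simp add: divide_ennreal add_divide_distrib)
    finally have "emeasure (distr ?U borel ?T) {..t} = emeasure cauchy {..t}"
      by (simp add: emeasure_cauchy_atMost)
    then show "cdf cauchy t = cdf (distr ?U borel ?T) t"
      by (simp add: cdf_def measure_def)
  qed
qed

lemma uniform_circle_eq_distr_cayley: "uniform_circle = distr cauchy borel cayley"
proof -
  have [measurable]: "(\<lambda>\<theta>. tan (\<theta> / 2 - pi / 2) :: real) \<in> borel_measurable borel"
    unfolding tan_def by measurable
  have "AE \<theta> in uniform_measure lborel {0..<2 * pi}. cis \<theta> = cayley (tan (\<theta> / 2 - pi / 2))"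
    using AE_lborel_singleton[of 0]
    by (intro AE_uniform_measureI)
       (auto elim!: eventually_mono intro!: cis_eq_cayley simp: less_le)
  then show ?thesis
    unfolding uniform_circle_def cauchy_eq_distr_tan
    by (subst distr_distr) (auto intro!: distr_cong_AE simp: o_def)
qed

text \<open>
  Stereographic projection may be taken from any point \<open>c\<close> of the circle, because the uniform
  measure is rotation invariant. Below, \<open>c\<close> is the first of the four points.
\<close>

lemma nn_integral_uniform_circle_cauchy:
  assumes "f \<in> borel_measurable borel" "norm c = 1"
  shows "(\<integral>\<^sup>+w. f w \<partial>uniform_circle) = (\<integral>\<^sup>+s. f (c * cayley s) \<partial>cauchy)"
  using assms
  by (subst nn_integral_rotate_uniform_circle[symmetric, of _ c])
     (auto simp: uniform_circle_eq_distr_cayley nn_integral_distr)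

lemma prob_space_uniform_circle: "prob_space uniform_circle"
  unfolding uniform_circle_eq_distr_cayley
  by (intro prob_space.prob_space_distr prob_space_cauchy) simp

text \<open>
  The Cayley map is injective, so a point of the circle corresponds to at most one real number.
\<close>

lemma emeasure_uniform_circle_singleton: "emeasure uniform_circle {w} = 0"
proof -
  have "emeasure uniform_circle {w} = emeasure cauchy (cayley -` {w})"
    unfolding uniform_circle_eq_distr_cayley by (subst emeasure_distr) auto
  also have "cayley -` {w} \<in> null_sets lborel"
    using finite_vimageI[OF _ inj_cayley, of "{w}"]
    by (intro finite_imp_null_set_lborel) simp
  then have "cayley -` {w} \<in> null_sets cauchy"
    unfolding cauchy_def using AE_not_in[of "cayley -` {w}" lborel]
    by (subst null_sets_density_iff) (auto elim!: eventually_mono)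
  then have "emeasure cauchy (cayley -` {w}) = 0" by (rule null_setsD1)
  finally show ?thesis .
qed

lemma AE_uniform_circle_norm: "AE w in uniform_circle. norm w = 1"
  unfolding uniform_circle_def
  by (subst AE_distr_iff) (auto intro!: AE_uniform_measureI)

lemma AE_uniform_circle_avoid:
  assumes "finite S"
  shows "AE w in uniform_circle. norm w = 1 \<and> w \<notin> S"
proof -
  have "AE w in uniform_circle. w \<noteq> s" for s
    by (rule AE_I'[of "{s}"]) (auto intro!: null_setsI emeasure_uniform_circle_singleton)
  then have "AE w in uniform_circle. \<forall>s\<in>S. w \<noteq> s"
    using assms by (intro AE_finite_allI) auto
  with AE_uniform_circle_norm show ?thesis by eventually_elim auto
qed

section \<open>The cross ratio of points on the circle\<close>

lemma cross_ratio_measurable [measurable]: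
  assumes [measurable]: "a \<in> borel_measurable M" "b \<in> borel_measurable M"
    "c \<in> borel_measurable M" "d \<in> borel_measurable M"
  shows "(\<lambda>x. cross_ratio (a x) (b x) (c x) (d x)) \<in> borel_measurable M"
  unfolding cross_ratio_def by measurable

text \<open>
  The cross ratio is invariant under Moebius maps, and seen from the projection centre \<open>w\<close> the
  first point lies at infinity, which leaves a quotient of two differences. Both sides are \<open>0\<close>
  when \<open>t = u\<close>, by the convention for division by zero.
\<close>

lemma cross_ratio_cayley:
  assumes "w \<noteq> 0"
  shows "cross_ratio w (w * cayley s) (w * cayley t) (w * cayley u) = of_real ((s - u) / (t - u))"
proof (cases "t = u")
  case True
  then show ?thesis by (simp add: cross_ratio_def)
next
  case False
  have one_minus: "1 - cayley x = 2 * \<i> / (of_real x + \<i>)" for x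
    by (simp add: cayley_def diff_divide_eq_iff)
  have diff: "cayley x - cayley y
      = 2 * \<i> * (of_real x - of_real y) / ((of_real x + \<i>) * (of_real y + \<i>))" for x y
  proof -
    have "cayley x - cayley y
        = ((of_real x - \<i>) * (of_real y + \<i>) - (of_real y - \<i>) * (of_real x + \<i>))
          / ((of_real x + \<i>) * (of_real y + \<i>))"
      by (simp add: cayley_def diff_frac_eq)
    also have "(of_real x - \<i>) * (of_real y + \<i>) - (of_real y - \<i>) * (of_real x + \<i>)
        = 2 * \<i> * (of_real x - of_real y)"
      by (simp add: algebra_simps)
    finally show ?thesis .
  qed
  have "cross_ratio w (w * cayley s) (w * cayley t) (w * cayley u)
      = (w * (1 - cayley t)) * (w * (cayley s - cayley u))
        / ((w * (1 - cayley s)) * (w * (cayley t - cayley u)))"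
    by (simp add: cross_ratio_def algebra_simps)
  also have "\<dots> = (1 - cayley t) * (cayley s - cayley u)
        / ((1 - cayley s) * (cayley t - cayley u))"
    using assms by simp
  also have "\<dots> = (of_real s - of_real u) / (of_real t - of_real u)"
    unfolding one_minus diff using False by (simp add: frac_eq_eq) (simp add: algebra_simps)
  finally show ?thesis by simp
qed

text \<open>
  On the unit circle conjugation is inversion, a Moebius map, and hence preserves the cross ratio.
\<close>

lemma cross_ratio_real:
  assumes "norm a = 1" "norm b = 1" "norm c = 1" "norm d = 1"
  shows "cross_ratio a b c d \<in> \<real>"
proof -
  have nz: "a \<noteq> 0" "b \<noteq> 0" "c \<noteq> 0" "d \<noteq> 0" using assms by auto
  have cnj: "cnj x - cnj y = - (x - y) / (x * y)" if "norm x = 1" "norm y = 1" for x y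
  proof -
    have "cnj x = 1 / x" "cnj y = 1 / y"
      using that by (simp_all add: divide_conv_cnj)
    moreover have "x \<noteq> 0" "y \<noteq> 0" using that by auto
    ultimately show ?thesis by (simp add: diff_frac_eq)
  qed
  have "cnj (cross_ratio a b c d) = cross_ratio a b c d"
    using nz assms by (simp add: cross_ratio_def cnj) (simp add: algebra_simps)
  then show ?thesis by (simp add: Reals_cnj_iff)
qed

section \<open>The integral of a product of three Cauchy densities\<close>

text \<open>
  The value of \<open>\<integral> c(s) c(s + a) c(s + b) ds\<close> for the Cauchy density \<open>c\<close>, in closed form.
\<close>

definition cauchy_triple :: "real \<Rightarrow> real \<Rightarrow> real" where
  "cauchy_triple a b = 2 * (12 + a\<^sup>2 - a * b + b\<^sup>2) / (pi\<^sup>2 * (4 + a\<^sup>2) * (4 + b\<^sup>2) * (4 + (a - b)\<^sup>2))"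

lemma tendsto_ln_square_diff:
  fixes a :: real
  shows "((\<lambda>s. ln (1 + (s + a)\<^sup>2) - ln (1 + s\<^sup>2)) \<longlongrightarrow> 0) at_top"
    and "((\<lambda>s. ln (1 + (s + a)\<^sup>2) - ln (1 + s\<^sup>2)) \<longlongrightarrow> 0) at_bot"
  by real_asymp+

lemma tendsto_arctan_shift:
  fixes a :: real
  shows "((\<lambda>s. arctan (s + a)) \<longlongrightarrow> pi / 2) at_top"
    and "((\<lambda>s. arctan (s + a)) \<longlongrightarrow> - (pi / 2)) at_bot"
  by real_asymp+

text \<open>
  The partial fraction decomposition used below for \<open>1 / ((1 + s\<^sup>2) (1 + (s + a)\<^sup>2) (1 + (s + b)\<^sup>2))\<close>,
  with denominators cleared.
\<close>

lemma cauchy_triple_identity: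
  fixes a b s :: real
  defines "d \<equiv> a - b"
  shows "(a * b - 4 - 2 * (a + b) * s) * d * (4 + d\<^sup>2) * (1 + (s + a)\<^sup>2) * (1 + (s + b)\<^sup>2)
    + (a * d - 4 + 2 * (a + d) * (s + a)) * b * (4 + b\<^sup>2) * (1 + s\<^sup>2) * (1 + (s + b)\<^sup>2)
    + (b * d + 4 + 2 * (d - b) * (s + b)) * a * (4 + a\<^sup>2) * (1 + s\<^sup>2) * (1 + (s + a)\<^sup>2)
    = a * b * d * (4 + a\<^sup>2) * (4 + b\<^sup>2) * (4 + d\<^sup>2)"
  unfolding d_def by algebra

text \<open>
  The sum of the three arctangent coefficients of that decomposition, with denominators cleared.
\<close>

lemma cauchy_triple_weights:
  fixes a b :: real
  defines "d \<equiv> a - b"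
  shows "(a * b - 4) * d * (4 + d\<^sup>2) + (a * d - 4) * b * (4 + b\<^sup>2) + (b * d + 4) * a * (4 + a\<^sup>2)
    = a * b * d * (2 * (12 + a\<^sup>2 - a * b + b\<^sup>2))"
  unfolding d_def by algebra

text \<open>
  Partial fractions give an antiderivative made of arctangents and differences of logarithms.
  Only the arctangents contribute, each growing by \<open>\<pi>\<close> along the line. The shifts have to be
  distinct for the poles to be simple.
\<close>

lemma nn_integral_cauchy_triple:
  assumes ab: "a \<noteq> 0" "b \<noteq> 0" "a \<noteq> b"
  shows "(\<integral>\<^sup>+s. ennreal (cauchy_density s * cauchy_density (s + a) * cauchy_density (s + b)) \<partial>lborel)
    = ennreal (cauchy_triple a b)"
proof -
  define d where "d = a - b"
  define A B D where "A = 4 + a\<^sup>2" and "B = 4 + b\<^sup>2" and "D = 4 + d\<^sup>2"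
  have nz: "a \<noteq> 0" "b \<noteq> 0" "d \<noteq> 0" "A \<noteq> 0" "B \<noteq> 0" "D \<noteq> 0"
    using ab by (auto simp: d_def A_def B_def D_def add_nonneg_eq_0_iff)
  \<comment> \<open>The partial fraction \<open>(\<alpha> + \<beta> x) / (1 + x\<^sup>2)\<close> at the poles \<open>x = \<plusminus>\<i>\<close> (with \<open>x\<close> one of
    \<open>s\<close>, \<open>s + a\<close>, \<open>s + b\<close>) is read off from the values of the other two factors there:
    if their shifts relative to \<open>x\<close> are \<open>p\<close> and \<open>q\<close>, then
    \<open>\<alpha> + \<beta> \<i> = 1 / (p q (p + 2 \<i>) (q + 2 \<i>))\<close>.\<close>
  define \<alpha>0 \<alpha>1 \<alpha>2 where "\<alpha>0 = (a * b - 4) / (a * b * A * B)"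
    and "\<alpha>1 = (a * d - 4) / (a * d * A * D)" and "\<alpha>2 = (b * d + 4) / (b * d * B * D)"
  define \<beta>0 \<beta>1 \<beta>2 where "\<beta>0 = - (2 * (a + b)) / (a * b * A * B)"
    and "\<beta>1 = 2 * (a + d) / (a * d * A * D)" and "\<beta>2 = 2 * (d - b) / (b * d * B * D)"
  \<comment> \<open>The \<open>\<beta>\<close> sum to zero, so the logarithms in the antiderivative occur only as differences,
    which vanish at both ends of the line.\<close>
  have \<beta>: "\<beta>0 = - \<beta>1 - \<beta>2"
  proof -
    have "- (2 * (a + b)) * (d * D) = - (2 * (a + d)) * (b * B) - 2 * (d - b) * (a * A)"
      unfolding A_def B_def D_def d_def by algebra
    then show ?thesis
      unfolding \<beta>0_def \<beta>1_def \<beta>2_def using nz by (simp add: divide_simps) (simp add: algebra_simps)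
  qed
  have \<alpha>: "(\<alpha>0 + \<alpha>1 + \<alpha>2) / pi\<^sup>2 = cauchy_triple a b"
  proof -
    have "\<alpha>0 + \<alpha>1 + \<alpha>2
        = ((a * b - 4) * d * D + (a * d - 4) * b * B + (b * d + 4) * a * A) / (a * b * d * A * B * D)"
      unfolding \<alpha>0_def \<alpha>1_def \<alpha>2_def using nz by (simp add: divide_simps)
    also have "\<dots> = 2 * (12 + a\<^sup>2 - a * b + b\<^sup>2) / (A * B * D)"
      unfolding A_def B_def D_def d_def cauchy_triple_weights
      using nz unfolding A_def B_def D_def d_def by (simp add: mult.assoc)
    finally show ?thesis
      by (simp add: cauchy_triple_def A_def B_def D_def d_def mult_ac)
  qed
  define F where "F s = (\<alpha>0 * arctan s + \<alpha>1 * arctan (s + a) + \<alpha>2 * arctan (s + b)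
      + \<beta>1 / 2 * (ln (1 + (s + a)\<^sup>2) - ln (1 + s\<^sup>2))
      + \<beta>2 / 2 * (ln (1 + (s + b)\<^sup>2) - ln (1 + s\<^sup>2))) / pi ^ 3" for s
  have deriv: "DERIV F s :> cauchy_density s * cauchy_density (s + a) * cauchy_density (s + b)" for s
  proof -
    define p q r where "p = 1 + s\<^sup>2" and "q = 1 + (s + a)\<^sup>2" and "r = 1 + (s + b)\<^sup>2"
    have pqr: "p \<noteq> 0" "q \<noteq> 0" "r \<noteq> 0" by (simp_all add: p_def q_def r_def)
    have frac: "x / k + y / k * w = (x + y * w) / k" for x y w k :: real
      by (simp add: add_divide_distrib)
    have "DERIV F s :> (\<alpha>0 * inverse p + \<alpha>1 * inverse q + \<alpha>2 * inverse r
        + \<beta>1 / 2 * (2 * (s + a) / q - 2 * s / p) + \<beta>2 / 2 * (2 * (s + b) / r - 2 * s / p)) / pi ^ 3"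
      unfolding F_def p_def q_def r_def
      by (rule DERIV_cdivide) (auto intro!: derivative_eq_intros simp: inverse_eq_divide)
    also have "\<alpha>0 * inverse p + \<alpha>1 * inverse q + \<alpha>2 * inverse r
        + \<beta>1 / 2 * (2 * (s + a) / q - 2 * s / p) + \<beta>2 / 2 * (2 * (s + b) / r - 2 * s / p)
      = (\<alpha>0 + \<beta>0 * s) / p + (\<alpha>1 + \<beta>1 * (s + a)) / q + (\<alpha>2 + \<beta>2 * (s + b)) / r"
      unfolding \<beta> using pqr by (simp add: divide_simps) (simp add: algebra_simps)
    also have "\<alpha>0 + \<beta>0 * s = (a * b - 4 - 2 * (a + b) * s) / (a * b * A * B)"
      unfolding \<alpha>0_def \<beta>0_def frac by (simp add: algebra_simps)
    also have "\<alpha>1 + \<beta>1 * (s + a) = (a * d - 4 + 2 * (a + d) * (s + a)) / (a * d * A * D)"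
      by (simp only: \<alpha>1_def \<beta>1_def frac)
    also have "\<alpha>2 + \<beta>2 * (s + b) = (b * d + 4 + 2 * (d - b) * (s + b)) / (b * d * B * D)"
      by (simp only: \<alpha>2_def \<beta>2_def frac)
    also have "(a * b - 4 - 2 * (a + b) * s) / (a * b * A * B) / p
        + (a * d - 4 + 2 * (a + d) * (s + a)) / (a * d * A * D) / q
        + (b * d + 4 + 2 * (d - b) * (s + b)) / (b * d * B * D) / r
      = ((a * b - 4 - 2 * (a + b) * s) * d * D * q * r
        + (a * d - 4 + 2 * (a + d) * (s + a)) * b * B * p * r
        + (b * d + 4 + 2 * (d - b) * (s + b)) * a * A * p * q) / (a * b * d * A * B * D * p * q * r)"
    proof -
      have "x0 / (a * b * A * B) / p + x1 / (a * d * A * D) / q + x2 / (b * d * B * D) / r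
        = (x0 * d * D * q * r + x1 * b * B * p * r + x2 * a * A * p * q)
          / (a * b * d * A * B * D * p * q * r)" for x0 x1 x2
        using nz pqr by (simp add: divide_simps) (algebra)
      then show ?thesis .
    qed
    also have "\<dots> = (a * b * d * A * B * D) / (a * b * d * A * B * D * p * q * r)"
      using cauchy_triple_identity[of a b s] unfolding A_def B_def D_def d_def p_def q_def r_def
      by simp
    also have "\<dots> = 1 / (p * q * r)" using nz by (simp add: mult.assoc)
    finally show ?thesis
      by (simp add: cauchy_density_def p_def q_def r_def power3_eq_cube mult_ac)
  qed
  have "(\<integral>\<^sup>+s. ennreal (cauchy_density s * cauchy_density (s + a) * cauchy_density (s + b)) \<partial>lborel)
      = ennreal ((\<alpha>0 + \<alpha>1 + \<alpha>2) * (pi / 2) / pi ^ 3 - (\<alpha>0 + \<alpha>1 + \<alpha>2) * (- (pi / 2)) / pi ^ 3)"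
  proof (rule nn_integral_FTC_line[OF _ deriv])
    have "(F \<longlongrightarrow> (\<alpha>0 * - (pi / 2) + \<alpha>1 * - (pi / 2) + \<alpha>2 * - (pi / 2)
        + \<beta>1 / 2 * 0 + \<beta>2 / 2 * 0) / pi ^ 3) at_bot"
      unfolding F_def
      by (intro tendsto_intros tendsto_ln_square_diff tendsto_arctan_shift tendsto_arctan_at_bot) simp
    then show "(F \<longlongrightarrow> (\<alpha>0 + \<alpha>1 + \<alpha>2) * (- (pi / 2)) / pi ^ 3) at_bot"
      by (simp add: algebra_simps add_divide_distrib)
    have "(F \<longlongrightarrow> (\<alpha>0 * (pi / 2) + \<alpha>1 * (pi / 2) + \<alpha>2 * (pi / 2)
        + \<beta>1 / 2 * 0 + \<beta>2 / 2 * 0) / pi ^ 3) at_top"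
      unfolding F_def
      by (intro tendsto_intros tendsto_ln_square_diff tendsto_arctan_shift tendsto_arctan_at_top) simp
    then show "(F \<longlongrightarrow> (\<alpha>0 + \<alpha>1 + \<alpha>2) * (pi / 2) / pi ^ 3) at_top"
      by (simp add: algebra_simps add_divide_distrib)
  qed simp_all
  also have "(\<alpha>0 + \<alpha>1 + \<alpha>2) * (pi / 2) / pi ^ 3 - (\<alpha>0 + \<alpha>1 + \<alpha>2) * (- (pi / 2)) / pi ^ 3
      = (\<alpha>0 + \<alpha>1 + \<alpha>2) / pi\<^sup>2"
    by (simp add: power3_eq_cube power2_eq_square)
  finally show ?thesis by (simp only: \<alpha>)
qed

lemma cauchy_triple_nonneg: "0 \<le> cauchy_triple a b"
proof -
  have "a\<^sup>2 - a * b + b\<^sup>2 = (a - b / 2)\<^sup>2 + 3 / 4 * b\<^sup>2"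
    by (simp add: power2_eq_square algebra_simps)
  then have "0 \<le> a\<^sup>2 - a * b + b\<^sup>2" by simp
  then show ?thesis by (simp add: cauchy_triple_def)
qed

section \<open>The law of a ratio of differences of Cauchy variables\<close>

text \<open>
  The three branches of the density are one formula; the case distinction only serves to write the
  logarithms without absolute values.
\<close>

lemma cross_ratio_density_eq:
  assumes "r \<noteq> 0" "r \<noteq> 1"
  shows "cross_ratio_density r = (ln \<bar>r\<bar> / (r - 1) - ln \<bar>1 - r\<bar> / r) / pi\<^sup>2"
proof -
  consider "r < 0" | "0 < r" "r < 1" | "1 < r" using assms by linarith
  then show ?thesis
  proof cases
    case 1
    have "1 - 1 / r = (1 - r) / (- r)" using 1 by (simp add: field_simps)
    then have "ln (1 - 1 / r) = ln (1 - r) - ln (- r)"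
      using 1 ln_div[of "1 - r" "- r"] by simp
    then show ?thesis
      using 1 by (simp add: cross_ratio_density_def divide_simps) (simp add: algebra_simps)
  next
    case 2
    then show ?thesis
      by (simp add: cross_ratio_density_def ln_div divide_simps) algebra
  next
    case 3
    then show ?thesis
      by (simp add: cross_ratio_density_def ln_div divide_simps) algebra
  qed
qed

text \<open>
  The partial fraction decomposition of \<open>cauchy_triple y (r * y)\<close> as a function of \<open>y\<^sup>2\<close>, with denominators
  cleared. In this form it also covers \<open>r = -1\<close>, \<open>r = 2\<close> and \<open>r = 1/2\<close>, where two of the three
  denominators coincide.
\<close>

lemma cauchy_triple_ratio_identity:
  fixes r y :: real
  shows "(4 + (r * y)\<^sup>2) * (4 + ((1 - r) * y)\<^sup>2) - r ^ 3 * (4 + y\<^sup>2) * (4 + ((1 - r) * y)\<^sup>2)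
     - (1 - r) ^ 3 * (4 + y\<^sup>2) * (4 + (r * y)\<^sup>2)
   = r * (1 - r) * (4 * (12 + y\<^sup>2 - y * (r * y) + (r * y)\<^sup>2))"
  by algebra

lemma tendsto_ln_ratio:
  fixes c :: real
  assumes "c \<noteq> 0"
  shows "((\<lambda>y. ln (4 + (c * y)\<^sup>2) - ln (4 + y\<^sup>2)) \<longlongrightarrow> 2 * ln \<bar>c\<bar>) at_top"
proof -
  have "0 < \<bar>c\<bar>" using assms by simp
  then have "((\<lambda>y. ln (4 + (\<bar>c\<bar> * y)\<^sup>2) - ln (4 + y\<^sup>2)) \<longlongrightarrow> ln (\<bar>c\<bar>\<^sup>2)) at_top"
    by real_asymp
  moreover have "ln (\<bar>c\<bar>\<^sup>2) = 2 * ln \<bar>c\<bar>"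
    using \<open>0 < \<bar>c\<bar>\<close> by (subst ln_realpow) simp_all
  ultimately have "((\<lambda>y. ln (4 + (\<bar>c\<bar> * y)\<^sup>2) - ln (4 + y\<^sup>2)) \<longlongrightarrow> 2 * ln \<bar>c\<bar>) at_top"
    by simp
  then show ?thesis by (simp add: power_mult_distrib)
qed

text \<open>
  Multiplied by \<open>y\<close>, that decomposition integrates to logarithms. Its coefficients add up so that
  the logarithms pair into differences with a limit at infinity, and the leading coefficients
  \<open>r\<^sup>2\<close> and \<open>(1 - r)\<^sup>2\<close> of their arguments produce \<open>ln \<bar>r\<bar>\<close> and \<open>ln \<bar>1 - r\<bar>\<close>.
\<close>

lemma nn_integral_abs_cauchy_triple:
  assumes r: "r \<noteq> 0" "r \<noteq> 1"
  shows "(\<integral>\<^sup>+y. ennreal (\<bar>y\<bar> * cauchy_triple y (r * y)) \<partial>lborel) = ennreal (cross_ratio_density r)"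
proof -
  define F where "F y = ((ln (4 + (r * y)\<^sup>2) - ln (4 + y\<^sup>2)) / (r - 1)
      - (ln (4 + ((1 - r) * y)\<^sup>2) - ln (4 + y\<^sup>2)) / r) / (4 * pi\<^sup>2)" for y
  \<comment> \<open>\<open>F\<close> is an antiderivative of \<open>y * cauchy_triple y (r * y)\<close>; it is even and vanishes at \<open>0\<close>,
    so each half-line contributes its limit \<open>L\<close> at infinity.\<close>
  define L where "L = cross_ratio_density r / 2"
  have deriv: "DERIV F y :> y * cauchy_triple y (r * y)" for y
  proof -
    define P Q R where "P = 4 + y\<^sup>2" and "Q = 4 + (r * y)\<^sup>2" and "R = 4 + ((1 - r) * y)\<^sup>2"
    have pos: "P > 0" "Q > 0" "R > 0"
      unfolding P_def Q_def R_def by (simp_all add: add_pos_nonneg)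
    have ln_deriv: "DERIV (\<lambda>y. ln (4 + (c * y)\<^sup>2) - ln (4 + y\<^sup>2)) y
        :> 2 * (c * y) * c / (4 + (c * y)\<^sup>2) - 2 * y / P" for c
      unfolding P_def by (auto intro!: derivative_eq_intros simp: add_pos_nonneg)
    have "DERIV F y :> ((2 * (r * y) * r / Q - 2 * y / P) / (r - 1)
        - (2 * ((1 - r) * y) * (1 - r) / R - 2 * y / P) / r) / (4 * pi\<^sup>2)"
      unfolding F_def Q_def R_def by (intro DERIV_cdivide DERIV_diff ln_deriv)
    also have "(2 * (r * y) * r / Q - 2 * y / P) / (r - 1)
        - (2 * ((1 - r) * y) * (1 - r) / R - 2 * y / P) / r
      = 2 * y * (Q * R - r ^ 3 * P * R - (1 - r) ^ 3 * P * Q) / (r * (1 - r)) / (P * Q * R)"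
      using pos r by (simp add: divide_simps) algebra
    also have "Q * R - r ^ 3 * P * R - (1 - r) ^ 3 * P * Q
        = r * (1 - r) * (4 * (12 + y\<^sup>2 - y * (r * y) + (r * y)\<^sup>2))"
      unfolding P_def Q_def R_def by (rule cauchy_triple_ratio_identity)
    also have "2 * y * (r * (1 - r) * (4 * (12 + y\<^sup>2 - y * (r * y) + (r * y)\<^sup>2))) / (r * (1 - r)) / (P * Q * R)
        / (4 * pi\<^sup>2) = y * (2 * (12 + y\<^sup>2 - y * (r * y) + (r * y)\<^sup>2) / (pi\<^sup>2 * P * Q * R))"
    proof -
      define N where "N = 12 + y\<^sup>2 - y * (r * y) + (r * y)\<^sup>2"
      have "r * (1 - r) \<noteq> 0" using r by simp
      then have "2 * y * (r * (1 - r) * (4 * N)) / (r * (1 - r)) = 8 * y * N" by simp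
      then show ?thesis unfolding N_def[symmetric] by (simp add: mult_ac)
    qed
    also have "R = 4 + (y - r * y)\<^sup>2" by (simp add: R_def algebra_simps)
    finally show ?thesis by (simp add: cauchy_triple_def P_def Q_def)
  qed
  have "(F \<longlongrightarrow> (2 * ln \<bar>r\<bar> / (r - 1) - 2 * ln \<bar>1 - r\<bar> / r) / (4 * pi\<^sup>2)) at_top"
    unfolding F_def using r by (intro tendsto_intros tendsto_ln_ratio) simp_all
  moreover have "(2 * ln \<bar>r\<bar> / (r - 1) - 2 * ln \<bar>1 - r\<bar> / r) / (4 * pi\<^sup>2) = L"
    unfolding L_def cross_ratio_density_eq[OF r] by (simp add: diff_divide_distrib mult_ac)
  ultimately have top: "(F \<longlongrightarrow> L) at_top" by simp
  have even: "F (- y) = F y" for y by (simp add: F_def)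
  have bot: "(F \<longlongrightarrow> L) at_bot"
    using filterlim_compose[OF top filterlim_uminus_at_top_at_bot] by (simp add: even)
  have [measurable]: "(\<lambda>y. \<bar>y\<bar> * cauchy_triple y (r * y)) \<in> borel_measurable borel"
    unfolding cauchy_triple_def by measurable
  have F0: "F 0 = 0" by (simp add: F_def)
  have "(\<integral>\<^sup>+y. ennreal (\<bar>y\<bar> * cauchy_triple y (r * y)) * indicator {0..} y \<partial>lborel)
      = ennreal (L - F 0)"
    using deriv top cauchy_triple_nonneg by (intro nn_integral_FTC_atLeast) simp_all
  moreover have "(\<integral>\<^sup>+y. ennreal (\<bar>y\<bar> * cauchy_triple y (r * y)) * indicator {..0} y \<partial>lborel)
      = ennreal (- F 0 - - L)"
  proof (rule nn_integral_FTC_atMost)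
    show "DERIV (\<lambda>y. - F y) y :> \<bar>y\<bar> * cauchy_triple y (r * y)" if "y \<le> 0" for y
      using DERIV_minus[OF deriv[of y]] that by simp
  qed (use bot cauchy_triple_nonneg in \<open>auto intro!: tendsto_minus mult_nonpos_nonneg\<close>)
  moreover have "0 \<le> L"
  proof -
    have "F 0 \<le> F y" if "0 \<le> y" for y
      using that by (rule DERIV_nonneg_imp_nondecreasing)
        (use deriv cauchy_triple_nonneg in \<open>metis mult_nonneg_nonneg\<close>)
    then show ?thesis
      by (intro tendsto_lowerbound[OF top]) (auto simp: F0 eventually_at_top_linorder)
  qed
  ultimately show ?thesis
    by (subst nn_integral_split_at[of _ 0]) (simp_all add: F0 L_def flip: ennreal_plus)
qed

lemma nn_integral_cauchy_ratio:
  assumes [measurable]: "A \<in> sets borel" and "t \<noteq> u"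
  shows "(\<integral>\<^sup>+s. indicator A ((s - u) / (t - u)) \<partial>cauchy)
    = (\<integral>\<^sup>+r. ennreal (\<bar>t - u\<bar> * cauchy_density (u + (t - u) * r)) * indicator A r \<partial>lborel)"
proof -
  have "(\<integral>\<^sup>+s. indicator A ((s - u) / (t - u)) \<partial>cauchy)
      = (\<integral>\<^sup>+s. ennreal (cauchy_density s) * indicator A ((s - u) / (t - u)) \<partial>lborel)"
    by (rule nn_integral_cauchy) measurable
  also have "\<dots> = ennreal \<bar>t - u\<bar> * (\<integral>\<^sup>+r. ennreal (cauchy_density (u + (t - u) * r)) * indicator A r \<partial>lborel)"
    using \<open>t \<noteq> u\<close> by (subst nn_integral_real_affine[where c="t - u" and t=u]) simp_all
  also have "\<dots> = (\<integral>\<^sup>+r. ennreal (\<bar>t - u\<bar> * cauchy_density (u + (t - u) * r)) * indicator A r \<partial>lborel)"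
    by (subst nn_integral_cmult[symmetric]) (auto simp: ennreal_mult mult.assoc)
  finally show ?thesis .
qed

text \<open>
  For independent Cauchy variables \<open>s\<close>, \<open>t\<close>, \<open>u\<close> the ratio \<open>(s - u) / (t - u)\<close> has the required
  density: with \<open>y = t - u\<close> and \<open>r\<close> the value of the ratio, the joint density of \<open>(u, y, r)\<close> is
  \<open>\<bar>y\<bar> c(u) c(u + y) c(u + r y)\<close>, from which \<open>u\<close> and then \<open>y\<close> are integrated out.
\<close>

lemma cauchy_ratio_law:
  assumes [measurable]: "A \<in> sets borel"
  shows "(\<integral>\<^sup>+u. \<integral>\<^sup>+t. \<integral>\<^sup>+s. indicator A ((s - u) / (t - u)) \<partial>cauchy \<partial>cauchy \<partial>cauchy)
    = (\<integral>\<^sup>+r. ennreal (cross_ratio_density r) * indicator A r \<partial>lborel)"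
proof -
  interpret C: prob_space cauchy by (rule prob_space_cauchy)
  define h where "h u y r = ennreal (\<bar>y\<bar> *
      (cauchy_density u * cauchy_density (u + y) * cauchy_density (u + r * y))) * indicator A r" for u y r
  \<comment> \<open>The substitution \<open>s = u + r (t - u)\<close>, followed by \<open>t = u + y\<close>.\<close>
  have inner: "ennreal (cauchy_density u) * (\<integral>\<^sup>+t. \<integral>\<^sup>+s. indicator A ((s - u) / (t - u)) \<partial>cauchy \<partial>cauchy)
      = (\<integral>\<^sup>+y. \<integral>\<^sup>+r. h u y r \<partial>lborel \<partial>lborel)" for u
  proof -
    define g where "g t = ennreal (cauchy_density t) *
      (\<integral>\<^sup>+r. ennreal (\<bar>t - u\<bar> * cauchy_density (u + (t - u) * r)) * indicator A r \<partial>lborel)" for t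
    have g [measurable]: "g \<in> borel_measurable borel" unfolding g_def by measurable
    have "(\<integral>\<^sup>+t. \<integral>\<^sup>+s. indicator A ((s - u) / (t - u)) \<partial>cauchy \<partial>cauchy)
        = (\<integral>\<^sup>+t. ennreal (cauchy_density t) * (\<integral>\<^sup>+s. indicator A ((s - u) / (t - u)) \<partial>cauchy) \<partial>lborel)"
      by (rule nn_integral_cauchy) measurable
    also have "\<dots> = (\<integral>\<^sup>+t. g t \<partial>lborel)"
      by (rule nn_integral_cong_AE)
         (use AE_lborel_singleton[of u] in \<open>auto elim!: eventually_mono simp: g_def nn_integral_cauchy_ratio\<close>)
    also have "\<dots> = (\<integral>\<^sup>+y. g (y + u) \<partial>lborel)"
      by (rule nn_integral_lborel_shift[symmetric]) measurable
    finally have "ennreal (cauchy_density u) * (\<integral>\<^sup>+t. \<integral>\<^sup>+s. indicator A ((s - u) / (t - u)) \<partial>cauchy \<partial>cauchy)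
        = (\<integral>\<^sup>+y. ennreal (cauchy_density u) * g (y + u) \<partial>lborel)"
      by (simp add: nn_integral_cmult)
    also have "\<dots> = (\<integral>\<^sup>+y. \<integral>\<^sup>+r. h u y r \<partial>lborel \<partial>lborel)"
      unfolding g_def h_def
      by (intro nn_integral_cong)
         (simp add: nn_integral_cmult[symmetric] ennreal_mult mult_ac add_ac)
    finally show ?thesis .
  qed
  have "(\<integral>\<^sup>+u. \<integral>\<^sup>+t. \<integral>\<^sup>+s. indicator A ((s - u) / (t - u)) \<partial>cauchy \<partial>cauchy \<partial>cauchy)
      = (\<integral>\<^sup>+u. \<integral>\<^sup>+y. \<integral>\<^sup>+r. h u y r \<partial>lborel \<partial>lborel \<partial>lborel)"
    unfolding inner[symmetric] by (rule nn_integral_cauchy) measurable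
  also have "\<dots> = (\<integral>\<^sup>+y. \<integral>\<^sup>+u. \<integral>\<^sup>+r. h u y r \<partial>lborel \<partial>lborel \<partial>lborel)"
    by (rule lborel_pair.Fubini') (unfold h_def, measurable)
  also have "\<dots> = (\<integral>\<^sup>+y. \<integral>\<^sup>+r. \<integral>\<^sup>+u. h u y r \<partial>lborel \<partial>lborel \<partial>lborel)"
    by (intro nn_integral_cong lborel_pair.Fubini') (unfold h_def, measurable)
  also have "\<dots> = (\<integral>\<^sup>+r. \<integral>\<^sup>+y. \<integral>\<^sup>+u. h u y r \<partial>lborel \<partial>lborel \<partial>lborel)"
    by (rule lborel_pair.Fubini') (unfold h_def, measurable)
  also have "\<dots> = (\<integral>\<^sup>+r. ennreal (cross_ratio_density r) * indicator A r \<partial>lborel)"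
  proof (rule nn_integral_cong_AE)
    have "(\<integral>\<^sup>+y. \<integral>\<^sup>+u. h u y r \<partial>lborel \<partial>lborel) = ennreal (cross_ratio_density r) * indicator A r"
      if r: "r \<noteq> 0" "r \<noteq> 1" for r
    proof -
      have "(\<integral>\<^sup>+u. h u y r \<partial>lborel) = ennreal (\<bar>y\<bar> * cauchy_triple y (r * y)) * indicator A r"
        if y: "y \<noteq> 0" for y
      proof -
        have "(\<integral>\<^sup>+u. h u y r \<partial>lborel) = ennreal \<bar>y\<bar> * indicator A r *
          (\<integral>\<^sup>+u. ennreal (cauchy_density u * cauchy_density (u + y) * cauchy_density (u + r * y)) \<partial>lborel)"
          unfolding h_def
          by (subst nn_integral_cmult[symmetric]) (auto intro!: nn_integral_cong simp: ennreal_mult mult_ac)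
        also have "\<dots> = ennreal \<bar>y\<bar> * indicator A r * ennreal (cauchy_triple y (r * y))"
          using y r by (subst nn_integral_cauchy_triple) auto
        finally show ?thesis by (simp add: ennreal_mult cauchy_triple_nonneg mult_ac)
      qed
      then have "(\<integral>\<^sup>+y. \<integral>\<^sup>+u. h u y r \<partial>lborel \<partial>lborel)
          = (\<integral>\<^sup>+y. ennreal (\<bar>y\<bar> * cauchy_triple y (r * y)) * indicator A r \<partial>lborel)"
        by (intro nn_integral_cong_AE)
           (use AE_lborel_singleton[of 0] in \<open>auto elim!: eventually_mono\<close>)
      also have "\<dots> = (\<integral>\<^sup>+y. ennreal (\<bar>y\<bar> * cauchy_triple y (r * y)) \<partial>lborel) * indicator A r"
        by (rule nn_integral_multc) (unfold cauchy_triple_def, measurable)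
      finally show ?thesis by (simp add: nn_integral_abs_cauchy_triple[OF r])
    qed
    moreover have "AE r in lborel. (r::real) \<noteq> 0 \<and> r \<noteq> 1"
      using AE_lborel_singleton[of 0] AE_lborel_singleton[of 1] by eventually_elim simp
    ultimately show "AE r in lborel. (\<integral>\<^sup>+y. \<integral>\<^sup>+u. h u y r \<partial>lborel \<partial>lborel)
        = ennreal (cross_ratio_density r) * indicator A r"
      by (metis (mono_tags, lifting) eventually_mono)
  qed
  finally show ?thesis .
qed

section \<open>Four independent points on the circle\<close>

text \<open>
  Conditionally on the first point, the other three are projected from it to the line, where they
  become independent Cauchy variables.
\<close>

lemma uniform_circle_cross_ratio_law:
  assumes [measurable]: "A \<in> sets borel"
  shows "(\<integral>\<^sup>+w1. \<integral>\<^sup>+w4. \<integral>\<^sup>+w3. \<integral>\<^sup>+w2. indicator A (Re (cross_ratio w1 w2 w3 w4))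
      \<partial>uniform_circle \<partial>uniform_circle \<partial>uniform_circle \<partial>uniform_circle)
    = (\<integral>\<^sup>+r. ennreal (cross_ratio_density r) * indicator A r \<partial>lborel)"
proof -
  interpret U: prob_space uniform_circle by (rule prob_space_uniform_circle)
  interpret C: prob_space cauchy by (rule prob_space_cauchy)
  define f where "f w1 w2 w3 w4 = (indicator A (Re (cross_ratio w1 w2 w3 w4)) :: ennreal)" for w1 w2 w3 w4
  \<comment> \<open>Every first point \<open>w1\<close> on the circle gives the same conditional law, so the outermost integration is
    over a constant.\<close>
  have "(\<integral>\<^sup>+w4. \<integral>\<^sup>+w3. \<integral>\<^sup>+w2. f w1 w2 w3 w4 \<partial>uniform_circle \<partial>uniform_circle \<partial>uniform_circle)
      = (\<integral>\<^sup>+r. ennreal (cross_ratio_density r) * indicator A r \<partial>lborel)"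
    if w1: "norm w1 = 1" for w1
  proof -
    have "(\<integral>\<^sup>+w4. \<integral>\<^sup>+w3. \<integral>\<^sup>+w2. f w1 w2 w3 w4 \<partial>uniform_circle \<partial>uniform_circle \<partial>uniform_circle)
        = (\<integral>\<^sup>+u. \<integral>\<^sup>+w3. \<integral>\<^sup>+w2. f w1 w2 w3 (w1 * cayley u) \<partial>uniform_circle \<partial>uniform_circle \<partial>cauchy)"
      by (rule nn_integral_uniform_circle_cauchy[OF _ w1]) (unfold f_def, measurable)
    also have "\<dots> = (\<integral>\<^sup>+u. \<integral>\<^sup>+t. \<integral>\<^sup>+w2. f w1 w2 (w1 * cayley t) (w1 * cayley u)
        \<partial>uniform_circle \<partial>cauchy \<partial>cauchy)"
      by (intro nn_integral_cong nn_integral_uniform_circle_cauchy[OF _ w1]) (unfold f_def, measurable)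
    also have "\<dots> = (\<integral>\<^sup>+u. \<integral>\<^sup>+t. \<integral>\<^sup>+s. f w1 (w1 * cayley s) (w1 * cayley t) (w1 * cayley u)
        \<partial>cauchy \<partial>cauchy \<partial>cauchy)"
      by (intro nn_integral_cong nn_integral_uniform_circle_cauchy[OF _ w1]) (unfold f_def, measurable)
    also have "\<dots> = (\<integral>\<^sup>+u. \<integral>\<^sup>+t. \<integral>\<^sup>+s. indicator A ((s - u) / (t - u)) \<partial>cauchy \<partial>cauchy \<partial>cauchy)"
      using w1 unfolding f_def by (subst cross_ratio_cayley) (auto simp del: of_real_divide)
    finally show ?thesis by (simp add: cauchy_ratio_law)
  qed
  then have "(\<integral>\<^sup>+w1. \<integral>\<^sup>+w4. \<integral>\<^sup>+w3. \<integral>\<^sup>+w2. f w1 w2 w3 w4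
        \<partial>uniform_circle \<partial>uniform_circle \<partial>uniform_circle \<partial>uniform_circle)
      = (\<integral>\<^sup>+w1. (\<integral>\<^sup>+r. ennreal (cross_ratio_density r) * indicator A r \<partial>lborel) \<partial>uniform_circle)"
    using AE_uniform_circle_norm by (intro nn_integral_cong_AE) (auto elim!: eventually_mono)
  then show ?thesis using U.emeasure_space_1 by (simp add: f_def)
qed

text \<open>
  Independence turns expectations into iterated integrals. The first point is the outermost
  variable, so that the integrals over the other points can be transformed with it held fixed.
\<close>

lemma nn_integral_four_circle_points:
  fixes M :: "'a measure" and z :: "nat \<Rightarrow> 'a \<Rightarrow> complex"
  assumes "prob_space M" and indep: "prob_space.indep_vars M (\<lambda>_. borel) z {1..4}"
    and law: "\<And>i. i \<in> {1..4} \<Longrightarrow> distr M borel (z i) = uniform_circle"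
    and F [measurable]: "F \<in> borel_measurable (borel \<Otimes>\<^sub>M borel \<Otimes>\<^sub>M borel \<Otimes>\<^sub>M borel)"
  shows "(\<integral>\<^sup>+\<omega>. F (z 1 \<omega>, z 2 \<omega>, z 3 \<omega>, z 4 \<omega>) \<partial>M)
    = (\<integral>\<^sup>+w1. \<integral>\<^sup>+w4. \<integral>\<^sup>+w3. \<integral>\<^sup>+w2. F (w1, w2, w3, w4)
        \<partial>uniform_circle \<partial>uniform_circle \<partial>uniform_circle \<partial>uniform_circle)"
proof -
  interpret prob_space M by fact
  interpret U: prob_space uniform_circle by (rule prob_space_uniform_circle)
  interpret P: product_sigma_finite "\<lambda>_::nat. uniform_circle" by standard
  define I :: "nat set" where "I = {1..4}"
  have z [measurable]: "z i \<in> borel_measurable M" if "i \<in> I" for i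
    using indep that by (auto simp: indep_vars_def I_def)
  \<comment> \<open>The order in which the coordinates are split off: the first is integrated innermost.\<close>
  have I: "I = {2, 3, 4, 1}" by (auto simp: I_def)
  have joint: "distr M (\<Pi>\<^sub>M i\<in>I. borel) (\<lambda>\<omega>. \<lambda>i\<in>I. z i \<omega>) = (\<Pi>\<^sub>M i\<in>I. uniform_circle)"
  proof -
    have "distr M (\<Pi>\<^sub>M i\<in>I. borel) (\<lambda>\<omega>. \<lambda>i\<in>I. z i \<omega>) = (\<Pi>\<^sub>M i\<in>I. distr M borel (z i))"
      using indep indep_vars_iff_distr_eq_PiM'[of I z "\<lambda>_. borel"] z by (auto simp: I_def)
    also have "\<dots> = (\<Pi>\<^sub>M i\<in>I. uniform_circle)"
      by (intro PiM_cong) (auto simp: law I_def)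
    finally show ?thesis .
  qed
  define G where "G x = F (x 1, x 2, x 3, x 4)" for x :: "nat \<Rightarrow> complex"
  have G [measurable]: "G \<in> borel_measurable (\<Pi>\<^sub>M i\<in>I. uniform_circle)"
    unfolding G_def I by measurable
  have "(\<integral>\<^sup>+\<omega>. F (z 1 \<omega>, z 2 \<omega>, z 3 \<omega>, z 4 \<omega>) \<partial>M) = (\<integral>\<^sup>+\<omega>. G (\<lambda>i\<in>I. z i \<omega>) \<partial>M)"
    by (simp add: G_def I_def)
  also have "\<dots> = (\<integral>\<^sup>+x. G x \<partial>distr M (\<Pi>\<^sub>M i\<in>I. borel) (\<lambda>\<omega>. \<lambda>i\<in>I. z i \<omega>))"
  proof (rule nn_integral_distr[symmetric])
    show "(\<lambda>\<omega>. \<lambda>i\<in>I. z i \<omega>) \<in> measurable M (\<Pi>\<^sub>M i\<in>I. borel)" by measurable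
  qed (unfold G_def I, measurable)
  also have "\<dots> = (\<integral>\<^sup>+x. G x \<partial>(\<Pi>\<^sub>M i\<in>{2::nat, 3, 4, 1}. uniform_circle))"
    unfolding joint by (simp only: I)
  also have "\<dots> = (\<integral>\<^sup>+x. \<integral>\<^sup>+w2. F (x 1, w2, x 3, x 4) \<partial>uniform_circle \<partial>(\<Pi>\<^sub>M i\<in>{3::nat, 4, 1}. uniform_circle))"
    using G unfolding I by (subst P.product_nn_integral_insert) (simp_all add: G_def)
  also have "\<dots> = (\<integral>\<^sup>+x. \<integral>\<^sup>+w3. \<integral>\<^sup>+w2. F (x 1, w2, w3, x 4) \<partial>uniform_circle \<partial>uniform_circle
      \<partial>(\<Pi>\<^sub>M i\<in>{4::nat, 1}. uniform_circle))"
    by (subst P.product_nn_integral_insert) simp_all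
  also have "\<dots> = (\<integral>\<^sup>+x. \<integral>\<^sup>+w4. \<integral>\<^sup>+w3. \<integral>\<^sup>+w2. F (x 1, w2, w3, w4) \<partial>uniform_circle \<partial>uniform_circle
      \<partial>uniform_circle \<partial>(\<Pi>\<^sub>M i\<in>{1::nat}. uniform_circle))"
    by (subst P.product_nn_integral_insert) simp_all
  also have "\<dots> = (\<integral>\<^sup>+w1. \<integral>\<^sup>+w4. \<integral>\<^sup>+w3. \<integral>\<^sup>+w2. F (w1, w2, w3, w4)
      \<partial>uniform_circle \<partial>uniform_circle \<partial>uniform_circle \<partial>uniform_circle)"
    by (rule P.product_nn_integral_singleton) measurable
  finally show ?thesis .
qed

theorem theorem4p1:
  fixes M :: "'a measure" and z :: "nat \<Rightarrow> 'a \<Rightarrow> complex"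
  assumes "prob_space M"
    and "prob_space.indep_vars M (\<lambda>_. borel) z {1..4}"
    and "\<And>i. i \<in> {1..4} \<Longrightarrow> distr M borel (z i) = uniform_circle"
  shows "(AE \<omega> in M. distinct [z 1 \<omega>, z 2 \<omega>, z 3 \<omega>, z 4 \<omega>] \<and>
            cross_ratio (z 1 \<omega>) (z 2 \<omega>) (z 3 \<omega>) (z 4 \<omega>) \<in> \<real>) \<and>
         distributed M lborel
           (\<lambda>\<omega>. Re (cross_ratio (z 1 \<omega>) (z 2 \<omega>) (z 3 \<omega>) (z 4 \<omega>)))
           (\<lambda>r. ennreal (cross_ratio_density r))"
proof (intro conjI)
  interpret prob_space M by fact
  interpret U: prob_space uniform_circle by (rule prob_space_uniform_circle)
  have z [measurable]: "z i \<in> borel_measurable M" if "i \<in> {1..4}" for i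
    using assms(2) that by (auto simp: indep_vars_def)
  have z' [measurable]: "z 1 \<in> borel_measurable M" "z 2 \<in> borel_measurable M"
    "z 3 \<in> borel_measurable M" "z 4 \<in> borel_measurable M"
    by (rule z; simp)+
  define G :: "(complex \<times> complex \<times> complex \<times> complex) set"
    where "G = {(a, b, c, d). norm a = 1 \<and> norm b = 1 \<and> norm c = 1 \<and> norm d = 1 \<and> distinct [a, b, c, d]}"
  have G [measurable]: "G \<in> sets (borel \<Otimes>\<^sub>M borel \<Otimes>\<^sub>M borel \<Otimes>\<^sub>M borel)"
  proof -
    have "Measurable.pred (borel \<Otimes>\<^sub>M borel \<Otimes>\<^sub>M borel \<Otimes>\<^sub>M borel)
      (\<lambda>(a::complex, b::complex, c::complex, d::complex).
        norm a = 1 \<and> norm b = 1 \<and> norm c = 1 \<and> norm d = 1 \<and>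
        a \<noteq> b \<and> a \<noteq> c \<and> a \<noteq> d \<and> b \<noteq> c \<and> b \<noteq> d \<and> c \<noteq> d)"
      by measurable
    then show ?thesis
      by (simp add: pred_def G_def space_pair_measure conj_ac case_prod_beta')
  qed
  have "(\<integral>\<^sup>+\<omega>. indicator (- G) (z 1 \<omega>, z 2 \<omega>, z 3 \<omega>, z 4 \<omega>) \<partial>M)
      = (\<integral>\<^sup>+w1. \<integral>\<^sup>+w4. \<integral>\<^sup>+w3. \<integral>\<^sup>+w2. indicator (- G) (w1, w2, w3, w4)
          \<partial>uniform_circle \<partial>uniform_circle \<partial>uniform_circle \<partial>uniform_circle)"
    by (rule nn_integral_four_circle_points[OF assms]) measurable
  also have "\<dots> = 0"
  proof -
    have zero: "(\<integral>\<^sup>+w. g w \<partial>uniform_circle) = 0"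
      if "finite S" "\<And>w. norm w = 1 \<Longrightarrow> w \<notin> S \<Longrightarrow> g w = 0" for g S
    proof -
      have "(\<integral>\<^sup>+w. g w \<partial>uniform_circle) = (\<integral>\<^sup>+w. 0 \<partial>uniform_circle)"
        by (intro nn_integral_cong_AE eventually_mono[OF AE_uniform_circle_avoid[OF that(1)]])
           (use that(2) in auto)
      then show ?thesis by simp
    qed
    \<comment> \<open>From the inside out: each point almost surely avoids the points fixed further outside.\<close>
    have i2: "(\<integral>\<^sup>+w2. indicator (- G) (w1, w2, w3, w4) \<partial>uniform_circle) = 0"
      if "norm w1 = 1" "norm w3 = 1" "norm w4 = 1" "distinct [w1, w3, w4]" for w1 w3 w4
      by (rule zero[of "{w1, w3, w4}"]) (use that in \<open>auto simp: G_def\<close>)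
    have i3: "(\<integral>\<^sup>+w3. \<integral>\<^sup>+w2. indicator (- G) (w1, w2, w3, w4) \<partial>uniform_circle \<partial>uniform_circle) = 0"
      if "norm w1 = 1" "norm w4 = 1" "w1 \<noteq> w4" for w1 w4
      by (rule zero[of "{w1, w4}"]) (use that i2 in auto)
    have i4: "(\<integral>\<^sup>+w4. \<integral>\<^sup>+w3. \<integral>\<^sup>+w2. indicator (- G) (w1, w2, w3, w4)
        \<partial>uniform_circle \<partial>uniform_circle \<partial>uniform_circle) = 0" if "norm w1 = 1" for w1
      by (rule zero[of "{w1}"]) (use that i3 in auto)
    show ?thesis by (rule zero[of "{}"]) (use i4 in auto)
  qed
  finally have "AE \<omega> in M. (z 1 \<omega>, z 2 \<omega>, z 3 \<omega>, z 4 \<omega>) \<in> G"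
    by (subst (asm) nn_integral_0_iff_AE) (auto simp: indicator_eq_0_iff)
  then show "AE \<omega> in M. distinct [z 1 \<omega>, z 2 \<omega>, z 3 \<omega>, z 4 \<omega>] \<and>
      cross_ratio (z 1 \<omega>) (z 2 \<omega>) (z 3 \<omega>) (z 4 \<omega>) \<in> \<real>"
    by eventually_elim (auto simp: G_def intro!: cross_ratio_real)
  let ?X = "\<lambda>\<omega>. Re (cross_ratio (z 1 \<omega>) (z 2 \<omega>) (z 3 \<omega>) (z 4 \<omega>))"
  have density: "(\<lambda>r. ennreal (cross_ratio_density r)) \<in> borel_measurable borel"
    unfolding cross_ratio_density_def by measurable
  have "distr M lborel ?X = density lborel (\<lambda>r. ennreal (cross_ratio_density r))"
  proof (rule measure_eqI)
    fix A assume "A \<in> sets (distr M lborel ?X)"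
    then have A [measurable]: "A \<in> sets borel" by simp
    have "emeasure (distr M lborel ?X) A = (\<integral>\<^sup>+x. indicator A x \<partial>distr M lborel ?X)"
      by simp
    also have "\<dots> = (\<integral>\<^sup>+\<omega>. indicator A (?X \<omega>) \<partial>M)"
      by (rule nn_integral_distr) measurable
    also have "\<dots> = (\<integral>\<^sup>+w1. \<integral>\<^sup>+w4. \<integral>\<^sup>+w3. \<integral>\<^sup>+w2. indicator A (Re (cross_ratio w1 w2 w3 w4))
        \<partial>uniform_circle \<partial>uniform_circle \<partial>uniform_circle \<partial>uniform_circle)"
      using nn_integral_four_circle_points[OF assms,
          of "\<lambda>(a, b, c, d). indicator A (Re (cross_ratio a b c d))"]
      by simp
    also have "\<dots> = (\<integral>\<^sup>+r. ennreal (cross_ratio_density r) * indicator A r \<partial>lborel)"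
      by (rule uniform_circle_cross_ratio_law) measurable
    also have "\<dots> = emeasure (density lborel (\<lambda>r. ennreal (cross_ratio_density r))) A"
      using density by (subst emeasure_density) simp_all
    finally show "emeasure (distr M lborel ?X) A
        = emeasure (density lborel (\<lambda>r. ennreal (cross_ratio_density r))) A" .
  qed simp
  with density show "distributed M lborel ?X (\<lambda>r. ennreal (cross_ratio_density r))"
    unfolding distributed_def by simp
qed

end
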